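(* Let $\mathcal{D}$ be the extended Dirac algebra, i.e. the unital associative $\mathbb{R}$-algebra generated by $\gamma^0,\gamma^1,\gamma^2,\gamma^3,i,C$ subject to $\{\gamma^\mu,\gamma^\nu\}=2\eta^{\mu\nu}$ (with $\eta=\mathrm{diag}(1,-1,-1,-1)$), $[i,\gamma^\mu]=0$, $\{C,\gamma^\mu\}=0$, $\{C,i\}=0$, $C^2=1$, $i^2=-1$. Let $\Lambda=\Lambda(\mathbb{R}^3)$ be the real $8$-dimensional space of (constant-coefficient) inhomogeneous differential forms on $\mathbb{R}^3$, the fibre of the exterior bundle. For $k=1,2,3$ let $\gamma^k$ act on $\Lambda$ by $\gamma^k=dx^k\wedge{}-\iota_{k}$, and let $\beta^k$ be the linear operator on $\Lambda$ determined by $$(\beta^k\gamma^k\varphi)_\kappa=(-1)^{\kappa_k}\varphi_\kappa\qquad\text{for all }\kappa\in(\mathbb{Z}_2)^3 .$$ Then there is a unique representation of $\mathcal{D}$ on $\Lambda$ in which each $\gamma^k$, $k=1,2,3$, acts as the operator $dx^k\wedge{}-\iota_k$ and in which $C=\beta^1$, $Ci=\beta^2$, $-i\gamma^0\gamma^1\gamma^2\gamma^3=\beta^3$, and this representation is equivalent (isomorphic as a real representation of $\mathcal{D}$) to the standard representation of $\mathcal{D}$ on Dirac spinors $\mathbb{C}^4\cong\mathbb{R}^8$.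
   Context: Notation: $\{a,b\}=ab+ba$ and $[a,b]=ab-ba$; $i$ is a generator of the real algebra $\mathcal{D}$, not a scalar. An element of $\Lambda$ is written $\varphi=\sum_{\kappa}\varphi_\kappa\,(dx^1)^{\kappa_1}(dx^2)^{\kappa_2}(dx^3)^{\kappa_3}$ with $\kappa=(\kappa_1,\kappa_2,\kappa_3)\in(\mathbb{Z}_2)^3$ (each $\kappa_j\in\{0,1\}$), $\varphi_\kappa\in\mathbb{R}$, and the product being the wedge product in the order written. $\iota_k$ denotes contraction (interior product) with $\partial/\partial x^k$; the operators $dx^k\wedge{}-\iota_k$ are the Clifford multiplications of Hodge theory, for which $\sum_k\gamma^k\partial_k=d+d^*$ on $\mathbb{R}^3$ with the Euclidean metric. The action on sections of the bundle is the pointwise one. The standard representation of $\mathcal{D}$ is the one on $\mathbb{C}^4$, regarded as a real vector space of dimension $8$, where $\gamma^\mu$ acts by the usual complex $4\times4$ Dirac matrices, $i$ acts as multiplication by the imaginary unit, and $C$ acts as charge conjugation, i.e. as an antilinear map with $C^2=1$ anticommuting with all $\gamma^\mu$. *)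

theory Defs
  imports "HOL-Analysis.Analysis"
begin

section \<open>The extended Dirac algebra\<close>

datatype coord = X1 | X2 | X3
datatype lorentz_index = Time | Space coord

instance coord :: finite
proof
  have "(UNIV :: coord set) = {X1, X2, X3}"
    using coord.exhaust by auto
  then show "finite (UNIV :: coord set)"
    by (metis finite.emptyI finite.insertI)
qed

lemma UNIV_coord: "(UNIV :: coord set) = {X1, X2, X3}"
  using coord.exhaust by auto

definition eta :: "lorentz_index \<Rightarrow> lorentz_index \<Rightarrow> real" where
  "eta \<mu> \<nu> = (if \<mu> \<noteq> \<nu> then 0 else if \<mu> = Time then 1 else -1)"

datatype dirac_gen = GGamma lorentz_index | GI | GC

text \<open>
  The algebra is the term algebra over the generators and the real scalars, divided by the
  least congruence that contains the axioms of unital associative real algebras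
  (with a scalar r standing for r times the unit) and the defining relations.
\<close>

datatype dirac_term =
    Gen dirac_gen
  | Scalar real
  | Plus dirac_term dirac_term
  | Times dirac_term dirac_term

inductive dirac_eq :: "dirac_term \<Rightarrow> dirac_term \<Rightarrow> bool" (infix "\<doteq>" 50) where
  refl: "a \<doteq> a"
| sym: "a \<doteq> b \<Longrightarrow> b \<doteq> a"
| trans: "a \<doteq> b \<Longrightarrow> b \<doteq> c \<Longrightarrow> a \<doteq> c"
| cong_plus: "a \<doteq> a' \<Longrightarrow> b \<doteq> b' \<Longrightarrow> Plus a b \<doteq> Plus a' b'"
| cong_times: "a \<doteq> a' \<Longrightarrow> b \<doteq> b' \<Longrightarrow> Times a b \<doteq> Times a' b'"
| plus_assoc: "Plus (Plus a b) c \<doteq> Plus a (Plus b c)"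
| plus_comm: "Plus a b \<doteq> Plus b a"
| plus_zero: "Plus (Scalar 0) a \<doteq> a"
| plus_inverse: "Plus (Times (Scalar (-1)) a) a \<doteq> Scalar 0"
| times_assoc: "Times (Times a b) c \<doteq> Times a (Times b c)"
| times_one_left: "Times (Scalar 1) a \<doteq> a"
| times_one_right: "Times a (Scalar 1) \<doteq> a"
| distrib_right: "Times (Plus a b) c \<doteq> Plus (Times a c) (Times b c)"
| distrib_left: "Times a (Plus b c) \<doteq> Plus (Times a b) (Times a c)"
| scalar_plus: "Scalar (r + s) \<doteq> Plus (Scalar r) (Scalar s)"
| scalar_times: "Scalar (r * s) \<doteq> Times (Scalar r) (Scalar s)"
| scalar_central: "Times (Scalar r) a \<doteq> Times a (Scalar r)"
| rel_gamma_gamma: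
    "Plus (Times (Gen (GGamma \<mu>)) (Gen (GGamma \<nu>))) (Times (Gen (GGamma \<nu>)) (Gen (GGamma \<mu>)))
      \<doteq> Scalar (2 * eta \<mu> \<nu>)"
| rel_i_gamma: "Times (Gen GI) (Gen (GGamma \<mu>)) \<doteq> Times (Gen (GGamma \<mu>)) (Gen GI)"
| rel_C_gamma:
    "Plus (Times (Gen GC) (Gen (GGamma \<mu>))) (Times (Gen (GGamma \<mu>)) (Gen GC)) \<doteq> Scalar 0"
| rel_C_i: "Plus (Times (Gen GC) (Gen GI)) (Times (Gen GI) (Gen GC)) \<doteq> Scalar 0"
| rel_C_C: "Times (Gen GC) (Gen GC) \<doteq> Scalar 1"
| rel_i_i: "Times (Gen GI) (Gen GI) \<doteq> Scalar (-1)"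

quotient_type dirac_algebra = dirac_term / dirac_eq
  by (intro equivpI reflpI sympI transpI) (blast intro: dirac_eq.intros)+


section \<open>Operators satisfying the relations\<close>

fun eval_term :: "(dirac_gen \<Rightarrow> 'v \<Rightarrow> 'v) \<Rightarrow> dirac_term \<Rightarrow> 'v \<Rightarrow> ('v :: real_vector)" where
  "eval_term g (Gen x) v = g x v"
| "eval_term g (Scalar r) v = r *\<^sub>R v"
| "eval_term g (Plus a b) v = eval_term g a v + eval_term g b v"
| "eval_term g (Times a b) v = eval_term g a (eval_term g b v)"

definition satisfies_dirac_relations :: "(dirac_gen \<Rightarrow> 'v \<Rightarrow> ('v :: real_vector)) \<Rightarrow> bool" where
  "satisfies_dirac_relations g \<longleftrightarrow>
     (\<forall>x. linear (g x)) \<and>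
     (\<forall>\<mu> \<nu> v. g (GGamma \<mu>) (g (GGamma \<nu>) v) + g (GGamma \<nu>) (g (GGamma \<mu>) v) = (2 * eta \<mu> \<nu>) *\<^sub>R v) \<and>
     (\<forall>\<mu> v. g GI (g (GGamma \<mu>) v) = g (GGamma \<mu>) (g GI v)) \<and>
     (\<forall>\<mu> v. g GC (g (GGamma \<mu>) v) + g (GGamma \<mu>) (g GC v) = 0) \<and>
     (\<forall>v. g GC (g GI v) + g GI (g GC v) = 0) \<and>
     (\<forall>v. g GC (g GC v) = v) \<and>
     (\<forall>v. g GI (g GI v) = - v)"

lemma linear_eval_term:
  assumes "\<And>x. linear (g x)"
  shows "linear (eval_term g t)"
proof (induction t)
  case (Gen x)
  then show ?case using assms by (simp add: linear_iff)
next
  case (Scalar r)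
  then show ?case by (simp add: linear_iff scaleR_add_right)
next
  case (Plus a b)
  then show ?case by (simp add: linear_iff scaleR_add_right)
next
  case (Times a b)
  then show ?case by (simp add: linear_iff)
qed

lemma eval_term_cong:
  assumes g: "satisfies_dirac_relations g" and "a \<doteq> b"
  shows "eval_term g a = eval_term g b"
proof -
  have lin: "linear (eval_term g t)" for t
    using g by (intro linear_eval_term) (simp add: satisfies_dirac_relations_def)
  have "eval_term g a v = eval_term g b v" for v
    using \<open>a \<doteq> b\<close>
  proof (induction arbitrary: v rule: dirac_eq.induct)
    case (distrib_left a b c)
    then show ?case using linear_add[OF lin] by simp
  next
    case (scalar_central r a)
    then show ?case using linear_scale[OF lin] by simp
  qed (use g in \<open>simp_all add: satisfies_dirac_relations_def add.assoc add.commute scaleR_add_left\<close>)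
  then show ?thesis by blast
qed


section \<open>Dirac spinors\<close>

type_synonym spinor = "complex ^ 4"

text \<open>
  The Dirac representation of the gamma matrices. The rows and columns are numbered 1 to 4.
\<close>

definition dirac_matrix :: "lorentz_index \<Rightarrow> complex ^ 4 ^ 4" where
  "dirac_matrix \<mu> = (case \<mu> of
     Time \<Rightarrow> vector [vector [1, 0, 0, 0],
                     vector [0, 1, 0, 0],
                     vector [0, 0, -1, 0],
                     vector [0, 0, 0, -1]]
   | Space X1 \<Rightarrow> vector [vector [0, 0, 0, 1],
                         vector [0, 0, 1, 0],
                         vector [0, -1, 0, 0],
                         vector [-1, 0, 0, 0]]
   | Space X2 \<Rightarrow> vector [vector [0, 0, 0, -\<i>],
                         vector [0, 0, \<i>, 0],
                         vector [0, \<i>, 0, 0],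
                         vector [-\<i>, 0, 0, 0]]
   | Space X3 \<Rightarrow> vector [vector [0, 0, 1, 0],
                         vector [0, 0, 0, -1],
                         vector [-1, 0, 0, 0],
                         vector [0, 1, 0, 0]])"

definition antilinear :: "(complex ^ 'n \<Rightarrow> complex ^ 'n) \<Rightarrow> bool" where
  "antilinear f \<longleftrightarrow> (\<forall>u v. f (u + v) = f u + f v) \<and> (\<forall>c v. f (c *s v) = cnj c *s f v)"

definition charge_conjugation :: "(spinor \<Rightarrow> spinor) \<Rightarrow> bool" where
  "charge_conjugation f \<longleftrightarrow>
     antilinear f \<and> f \<circ> f = id \<and>
     (\<forall>\<mu> \<psi>. f (dirac_matrix \<mu> *v \<psi>) + dirac_matrix \<mu> *v f \<psi> = 0)"

lemma vector_4_nth [simp]: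
  "(vector [a, b, c, d] :: 'a::zero ^ 4) $ 1 = a"
  "(vector [a, b, c, d] :: 'a::zero ^ 4) $ 2 = b"
  "(vector [a, b, c, d] :: 'a::zero ^ 4) $ 3 = c"
  "(vector [a, b, c, d] :: 'a::zero ^ 4) $ 4 = d"
  by (simp_all add: vector_def)

lemmas dirac_matrix_simps =
  dirac_matrix_def matrix_vector_mult_def vec_eq_iff forall_4 sum_4

lemma charge_conjugation_exists:
  "charge_conjugation (\<lambda>\<psi>. vector [cnj (\<psi> $ 4), - cnj (\<psi> $ 3), - cnj (\<psi> $ 2), cnj (\<psi> $ 1)])"
  (is "charge_conjugation ?f")
proof -
  have "?f (dirac_matrix \<mu> *v \<psi>) + dirac_matrix \<mu> *v ?f \<psi> = 0" for \<mu> \<psi>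
    by (cases \<mu>) (auto simp: dirac_matrix_simps split: coord.split)
  moreover have "antilinear ?f"
    by (simp add: antilinear_def vec_eq_iff forall_4)
  moreover have "?f \<circ> ?f = id"
    by (simp add: fun_eq_iff vec_eq_iff forall_4)
  ultimately show ?thesis
    unfolding charge_conjugation_def by blast
qed

fun spinor_gen :: "(spinor \<Rightarrow> spinor) \<Rightarrow> dirac_gen \<Rightarrow> spinor \<Rightarrow> spinor" where
  "spinor_gen f (GGamma \<mu>) \<psi> = dirac_matrix \<mu> *v \<psi>"
| "spinor_gen f GI \<psi> = \<i> *s \<psi>"
| "spinor_gen f GC \<psi> = f \<psi>"

lemma dirac_matrix_relation:
  "dirac_matrix \<mu> *v (dirac_matrix \<nu> *v \<psi>) + dirac_matrix \<nu> *v (dirac_matrix \<mu> *v \<psi>)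
     = (2 * eta \<mu> \<nu>) *\<^sub>R \<psi>"
  by (cases \<mu>; cases \<nu>)
    (auto simp: dirac_matrix_simps eta_def scaleR_conv_of_real algebra_simps split: coord.split)

lemma spinor_gen_relations:
  assumes f: "charge_conjugation f"
  shows "satisfies_dirac_relations (spinor_gen f)"
proof -
  have add: "f (u + v) = f u + f v" and scale: "f (c *s v) = cnj c *s f v" for u v c
    using f by (auto simp: charge_conjugation_def antilinear_def)
  have real_scale: "r *\<^sub>R v = complex_of_real r *s v" for r and v :: spinor
    by (simp add: vec_eq_iff scaleR_conv_of_real [where 'a = complex])
  have mul_scale: "A *v (c *s v) = c *s (A *v v)" for A :: "complex ^ 4 ^ 4" and c v
    by (simp add: vector_scalar_commute)
  have "linear (spinor_gen f x)" for x
  proof (cases x)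
    case (GGamma \<mu>)
    then have "spinor_gen f x = (*v) (dirac_matrix \<mu>)" by auto
    then show ?thesis
      by (simp add: linear_iff matrix_vector_right_distrib real_scale mul_scale)
  qed (simp_all add: linear_iff real_scale add scale vec_eq_iff algebra_simps)
  moreover have "f (f v) = v" for v
    using f by (metis charge_conjugation_def comp_apply id_apply)
  ultimately show ?thesis
    using f dirac_matrix_relation
    unfolding satisfies_dirac_relations_def charge_conjugation_def
    by (auto simp: scale mul_scale vec_eq_iff simp del: add_eq_0_iff)
qed


section \<open>Algebra structure and representations\<close>

instantiation dirac_algebra :: real_algebra_1
begin

lift_definition zero_dirac_algebra :: dirac_algebra is "Scalar 0" .
lift_definition one_dirac_algebra :: dirac_algebra is "Scalar 1" .
lift_definition plus_dirac_algebra :: "dirac_algebra \<Rightarrow> dirac_algebra \<Rightarrow> dirac_algebra" is Plus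
  by (rule dirac_eq.cong_plus)
lift_definition times_dirac_algebra :: "dirac_algebra \<Rightarrow> dirac_algebra \<Rightarrow> dirac_algebra" is Times
  by (rule dirac_eq.cong_times)
lift_definition scaleR_dirac_algebra :: "real \<Rightarrow> dirac_algebra \<Rightarrow> dirac_algebra"
  is "\<lambda>r a. Times (Scalar r) a"
  by (intro dirac_eq.cong_times dirac_eq.refl)
lift_definition uminus_dirac_algebra :: "dirac_algebra \<Rightarrow> dirac_algebra"
  is "\<lambda>a. Times (Scalar (-1)) a"
  by (intro dirac_eq.cong_times dirac_eq.refl)
definition minus_dirac_algebra :: "dirac_algebra \<Rightarrow> dirac_algebra \<Rightarrow> dirac_algebra" where
  "minus_dirac_algebra a b = a + (- b)"

instance
proof
  fix a b c :: dirac_algebra and r s :: real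
  show "a + b + c = a + (b + c)" by transfer (rule dirac_eq.plus_assoc)
  show "a + b = b + a" by transfer (rule dirac_eq.plus_comm)
  show "0 + a = a" by transfer (rule dirac_eq.plus_zero)
  show "- a + a = 0" by transfer (rule dirac_eq.plus_inverse)
  show "a - b = a + - b" by (rule minus_dirac_algebra_def)
  show "a * b * c = a * (b * c)" by transfer (rule dirac_eq.times_assoc)
  show "1 * a = a" by transfer (rule dirac_eq.times_one_left)
  show "a * 1 = a" by transfer (rule dirac_eq.times_one_right)
  show "(a + b) * c = a * c + b * c" by transfer (rule dirac_eq.distrib_right)
  show "a * (b + c) = a * b + a * c" by transfer (rule dirac_eq.distrib_left)
  show "r *\<^sub>R (a + b) = r *\<^sub>R a + r *\<^sub>R b" by transfer (rule dirac_eq.distrib_left)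
  show "(r + s) *\<^sub>R a = r *\<^sub>R a + s *\<^sub>R a"
    by transfer (meson dirac_eq.intros)
  show "r *\<^sub>R s *\<^sub>R a = (r * s) *\<^sub>R a"
    by transfer (meson dirac_eq.intros)
  show "1 *\<^sub>R a = a" by transfer (rule dirac_eq.times_one_left)
  show "r *\<^sub>R a * b = r *\<^sub>R (a * b)" by transfer (rule dirac_eq.times_assoc)
  show "a * r *\<^sub>R b = r *\<^sub>R (a * b)"
    by transfer (meson dirac_eq.intros)
  show "(0 :: dirac_algebra) \<noteq> 1"
  proof (transfer, rule notI)
    assume "Scalar 0 \<doteq> Scalar 1"
    then have "eval_term g (Scalar 0) = eval_term g (Scalar 1)"
      if "satisfies_dirac_relations g" for g :: "dirac_gen \<Rightarrow> spinor \<Rightarrow> spinor"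
      using eval_term_cong that by blast
    then have "eval_term g (Scalar 0) 1 = eval_term g (Scalar 1) (1 :: spinor)"
      if "satisfies_dirac_relations g" for g :: "dirac_gen \<Rightarrow> spinor \<Rightarrow> spinor"
      using that by metis
    then show False
      using spinor_gen_relations[OF charge_conjugation_exists] by auto
  qed
qed

end

lift_definition gamma :: "lorentz_index \<Rightarrow> dirac_algebra" is "\<lambda>\<mu>. Gen (GGamma \<mu>)" .
lift_definition imag_unit :: dirac_algebra is "Gen GI" .
lift_definition charge_conj :: dirac_algebra is "Gen GC" .

lemma dirac_algebra_relations:
  "gamma \<mu> * gamma \<nu> + gamma \<nu> * gamma \<mu> = (2 * eta \<mu> \<nu>) *\<^sub>R 1"
  "imag_unit * gamma \<mu> - gamma \<mu> * imag_unit = 0"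
  "charge_conj * gamma \<mu> + gamma \<mu> * charge_conj = 0"
  "charge_conj * imag_unit + imag_unit * charge_conj = 0"
  "charge_conj * charge_conj = 1"
  "imag_unit * imag_unit = -1"
proof -
  show "gamma \<mu> * gamma \<nu> + gamma \<nu> * gamma \<mu> = (2 * eta \<mu> \<nu>) *\<^sub>R 1"
    by transfer (meson dirac_eq.intros)
  show "imag_unit * gamma \<mu> - gamma \<mu> * imag_unit = 0"
    unfolding right_minus_eq by transfer (rule dirac_eq.rel_i_gamma)
  show "charge_conj * gamma \<mu> + gamma \<mu> * charge_conj = 0" by transfer (rule dirac_eq.rel_C_gamma)
  show "charge_conj * imag_unit + imag_unit * charge_conj = 0" by transfer (rule dirac_eq.rel_C_i)
  show "charge_conj * charge_conj = 1" by transfer (rule dirac_eq.rel_C_C)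
  show "imag_unit * imag_unit = -1" by transfer (meson dirac_eq.intros)
qed

definition is_representation :: "(dirac_algebra \<Rightarrow> 'v \<Rightarrow> ('v :: real_vector)) \<Rightarrow> bool" where
  "is_representation \<rho> \<longleftrightarrow>
     (\<forall>a. linear (\<rho> a)) \<and>
     (\<forall>a b v. \<rho> (a + b) v = \<rho> a v + \<rho> b v) \<and>
     (\<forall>r a v. \<rho> (r *\<^sub>R a) v = r *\<^sub>R \<rho> a v) \<and>
     (\<forall>a b. \<rho> (a * b) = \<rho> a \<circ> \<rho> b) \<and>
     \<rho> 1 = id"

definition equivalent_representations ::
    "(dirac_algebra \<Rightarrow> 'v \<Rightarrow> ('v :: real_vector)) \<Rightarrow> (dirac_algebra \<Rightarrow> 'w \<Rightarrow> ('w :: real_vector)) \<Rightarrow> bool" where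
  "equivalent_representations \<rho> \<sigma> \<longleftrightarrow>
     (\<exists>T. linear T \<and> bij T \<and> (\<forall>a v. T (\<rho> a v) = \<sigma> a (T v)))"

lemma representation_of_generators:
  assumes g: "satisfies_dirac_relations g"
  shows "\<exists>!\<rho>. is_representation \<rho> \<and>
           (\<forall>\<mu>. \<rho> (gamma \<mu>) = g (GGamma \<mu>)) \<and> \<rho> imag_unit = g GI \<and> \<rho> charge_conj = g GC"
proof -
  define \<rho> where "\<rho> a = eval_term g (rep_dirac_algebra a)" for a
  have abs: "\<rho> (abs_dirac_algebra t) = eval_term g t" for t
    unfolding \<rho>_def by (intro eval_term_cong[OF g] Quotient3_rep_abs[OF Quotient3_dirac_algebra] dirac_eq.refl)
  have rep: "is_representation \<rho>"
  proof -
    have lin: "linear (\<rho> a)" for a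
      unfolding \<rho>_def using g
      by (intro linear_eval_term) (simp add: satisfies_dirac_relations_def)
    have "\<rho> (a + b) v = \<rho> a v + \<rho> b v" for a b v
      by (induction a; induction b) (simp add: plus_dirac_algebra.abs_eq abs)
    moreover have "\<rho> (r *\<^sub>R a) v = r *\<^sub>R \<rho> a v" for r a v
      by (induction a) (simp add: scaleR_dirac_algebra.abs_eq abs)
    moreover have "\<rho> (a * b) = \<rho> a \<circ> \<rho> b" for a b
      by (induction a; induction b) (simp add: times_dirac_algebra.abs_eq abs fun_eq_iff)
    moreover have "\<rho> 1 = id"
      by (simp add: one_dirac_algebra_def abs fun_eq_iff)
    ultimately show ?thesis
      using lin unfolding is_representation_def by blast
  qed
  have gens: "(\<forall>\<mu>. \<rho> (gamma \<mu>) = g (GGamma \<mu>)) \<and> \<rho> imag_unit = g GI \<and> \<rho> charge_conj = g GC"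
    by (simp add: gamma_def imag_unit_def charge_conj_def abs fun_eq_iff)
  have unique: "\<rho>' = \<rho>"
    if r: "is_representation \<rho>'"
      and gen: "\<forall>\<mu>. \<rho>' (gamma \<mu>) = g (GGamma \<mu>)" "\<rho>' imag_unit = g GI" "\<rho>' charge_conj = g GC" for \<rho>'
  proof -
    have "\<rho>' (abs_dirac_algebra t) v = eval_term g t v" for t v
    proof (induction t arbitrary: v)
      case (Gen x)
      then show ?case
        using gen by (cases x) (simp_all add: gamma_def imag_unit_def charge_conj_def)
    next
      case (Scalar s)
      have "abs_dirac_algebra (Scalar s) = s *\<^sub>R 1"
        unfolding one_dirac_algebra_def scaleR_dirac_algebra.abs_eq dirac_algebra.abs_eq_iff
        by (meson dirac_eq.intros)
      then show ?case
        using r by (simp add: is_representation_def)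
    next
      case (Plus a b)
      then show ?case
        using r by (simp add: is_representation_def flip: plus_dirac_algebra.abs_eq)
    next
      case (Times a b)
      then show ?case
        using r by (simp add: is_representation_def flip: times_dirac_algebra.abs_eq)
    qed
    then have "\<rho>' (abs_dirac_algebra t) = \<rho> (abs_dirac_algebra t)" for t
      by (simp add: abs fun_eq_iff)
    then have "\<rho>' a = \<rho> a" for a
      by (induction a) simp
    then show ?thesis by blast
  qed
  show ?thesis
    using rep gens unique by blast
qed

text \<open>
  Charge conjugation is determined only up to a phase, so this is a predicate:
  every admissible choice gives a standard representation.
\<close>

definition standard_representation :: "(dirac_algebra \<Rightarrow> spinor \<Rightarrow> spinor) \<Rightarrow> bool" where
  "standard_representation \<sigma> \<longleftrightarrow>
     is_representation \<sigma> \<and>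
     (\<forall>\<mu>. \<sigma> (gamma \<mu>) = (\<lambda>\<psi>. dirac_matrix \<mu> *v \<psi>)) \<and>
     \<sigma> imag_unit = (\<lambda>\<psi>. \<i> *s \<psi>) \<and>
     charge_conjugation (\<sigma> charge_conj)"

lemma standard_representation_exists: "\<exists>\<sigma>. standard_representation \<sigma>"
proof -
  obtain f where f: "charge_conjugation f"
    using charge_conjugation_exists by blast
  obtain \<sigma> where rep: "is_representation \<sigma>"
    and gen: "\<And>\<mu>. \<sigma> (gamma \<mu>) = spinor_gen f (GGamma \<mu>)"
      "\<sigma> imag_unit = spinor_gen f GI" "\<sigma> charge_conj = spinor_gen f GC"
    using ex1_implies_ex [OF representation_of_generators [OF spinor_gen_relations [OF f]]]
    by auto
  have "spinor_gen f GC = f" by (rule ext) simp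
  moreover have "spinor_gen f GI = (\<lambda>\<psi>. \<i> *s \<psi>)" by (rule ext) simp
  moreover have "spinor_gen f (GGamma \<mu>) = (\<lambda>\<psi>. dirac_matrix \<mu> *v \<psi>)" for \<mu>
    by (rule ext) simp
  ultimately have "standard_representation \<sigma>"
    unfolding standard_representation_def using rep gen f by (simp only: simp_thms)
  then show ?thesis by blast
qed


section \<open>Inhomogeneous forms on three-space\<close>

text \<open>
  The component of a form at \<open>\<kappa>\<close> is the coefficient of the wedge product, in increasing order,
  of the coordinate differentials \<open>dx k\<close> with \<open>\<kappa> k\<close>.
\<close>

type_synonym form = "real ^ (coord \<Rightarrow> bool)"

fun coord_num :: "coord \<Rightarrow> nat" where
  "coord_num X1 = 1"
| "coord_num X2 = 2"
| "coord_num X3 = 3"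

definition basis_form :: "(coord \<Rightarrow> bool) \<Rightarrow> form" where
  "basis_form \<kappa> = axis \<kappa> 1"

text \<open>
  The sign counts the transpositions needed to sort the product of the basis forms
  at \<open>\<alpha>\<close> and \<open>\<beta>\<close>.
\<close>

definition wedge_sign :: "(coord \<Rightarrow> bool) \<Rightarrow> (coord \<Rightarrow> bool) \<Rightarrow> real" where
  "wedge_sign \<alpha> \<beta> = (-1) ^ card {(j, k). \<alpha> j \<and> \<beta> k \<and> coord_num k < coord_num j}"

definition wedge :: "form \<Rightarrow> form \<Rightarrow> form" (infixr "\<and>\<^sub>f" 70) where
  "\<phi> \<and>\<^sub>f \<psi> = (\<chi> \<kappa>. \<Sum>(\<alpha>, \<beta>) \<in> {(\<alpha>, \<beta>). (\<forall>k. \<not> (\<alpha> k \<and> \<beta> k)) \<and> (\<forall>k. \<kappa> k \<longleftrightarrow> \<alpha> k \<or> \<beta> k)}.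
     wedge_sign \<alpha> \<beta> * \<phi> $ \<alpha> * \<psi> $ \<beta>)"

definition dx :: "coord \<Rightarrow> form" where
  "dx k = basis_form (\<lambda>j. j = k)"

text \<open>The interior product with the k-th coordinate vector field.\<close>

definition contract :: "coord \<Rightarrow> form \<Rightarrow> form" where
  "contract k \<phi> = (\<chi> \<kappa>. if \<kappa> k then 0
     else (-1) ^ card {j. \<kappa> j \<and> coord_num j < coord_num k} * \<phi> $ (\<kappa>(k := True)))"

definition clifford :: "coord \<Rightarrow> form \<Rightarrow> form" where
  "clifford k \<phi> = dx k \<and>\<^sub>f \<phi> - contract k \<phi>"

text \<open>The sign picked up by moving \<open>dx k\<close> into its place in the product at \<open>\<kappa>\<close>.\<close>

definition place_sign :: "coord \<Rightarrow> (coord \<Rightarrow> bool) \<Rightarrow> real" where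
  "place_sign k \<kappa> = (-1) ^ card {j. \<kappa> j \<and> coord_num j < coord_num k}"

lemma place_sign_upd [simp]: "place_sign k (\<kappa>(k := b)) = place_sign k \<kappa>"
  unfolding place_sign_def by (intro arg_cong [where f = "\<lambda>A. (-1) ^ card A"]) auto

lemma place_sign_square [simp]: "place_sign k \<kappa> * place_sign k \<kappa> = 1"
  by (simp add: place_sign_def flip: power_mult_distrib)

lemma contract_nth:
  "contract k \<phi> $ \<kappa> = (if \<kappa> k then 0 else place_sign k \<kappa> * \<phi> $ (\<kappa>(k := True)))"
  by (simp add: contract_def place_sign_def)

lemma wedge_sign_dx: "wedge_sign (\<lambda>j. j = k) \<beta> = place_sign k \<beta>"
proof -
  have "{(j, l). j = k \<and> \<beta> l \<and> coord_num l < coord_num j}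
          = Pair k ` {l. \<beta> l \<and> coord_num l < coord_num k}"
    by auto
  then show ?thesis
    unfolding wedge_sign_def place_sign_def by (simp add: card_image inj_on_def)
qed

lemma dx_wedge_nth:
  "(dx k \<and>\<^sub>f \<phi>) $ \<kappa> = (if \<kappa> k then place_sign k \<kappa> * \<phi> $ (\<kappa>(k := False)) else 0)"
proof -
  define S where
    "S = {(\<alpha>, \<beta>). (\<forall>k. \<not> (\<alpha> k \<and> \<beta> k)) \<and> (\<forall>k. \<kappa> k \<longleftrightarrow> \<alpha> k \<or> \<beta> k)}"
  define p where "p = (\<lambda>j. j = k, \<kappa>(k := False))"
  define h where "h = (\<lambda>(\<alpha>, \<beta>). wedge_sign \<alpha> \<beta> * dx k $ \<alpha> * \<phi> $ \<beta>)"
  have zero: "h q = 0" if "q \<in> S - {p}" for q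
  proof -
    obtain \<alpha> \<beta> where q: "q = (\<alpha>, \<beta>)" by (cases q)
    then have disj: "\<And>j. \<not> (\<alpha> j \<and> \<beta> j)" and un: "\<And>j. \<kappa> j \<longleftrightarrow> \<alpha> j \<or> \<beta> j"
      using that by (simp_all add: S_def)
    have "\<alpha> \<noteq> (\<lambda>j. j = k)"
    proof
      assume a: "\<alpha> = (\<lambda>j. j = k)"
      have "\<beta> j = (\<kappa>(k := False)) j" for j
        using disj [of j] un [of j] by (cases "j = k") (simp_all add: a)
      then have "\<beta> = \<kappa>(k := False)" by (rule ext)
      then show False using that a by (simp add: q p_def)
    qed
    then show ?thesis by (simp add: q h_def dx_def basis_form_def axis_def)
  qed
  have "(dx k \<and>\<^sub>f \<phi>) $ \<kappa> = sum h S"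
    by (simp add: wedge_def S_def h_def)
  also have "\<dots> = sum h (S \<inter> {p})"
    by (rule sum.mono_neutral_right) (use zero in auto)
  also have "\<dots> = (if p \<in> S then h p else 0)"
    by simp
  also have "p \<in> S \<longleftrightarrow> \<kappa> k"
    by (auto simp: p_def S_def)
  also have "h p = place_sign k \<kappa> * \<phi> $ (\<kappa>(k := False))"
    by (simp add: h_def p_def wedge_sign_dx dx_def basis_form_def axis_def)
  finally show ?thesis .
qed

lemma place_sign_simps:
  "place_sign X1 \<kappa> = 1"
  "place_sign X2 \<kappa> = (-1) ^ of_bool (\<kappa> X1)"
  "place_sign X3 \<kappa> = (-1) ^ (of_bool (\<kappa> X1) + of_bool (\<kappa> X2))"
proof -
  have all: "{j. P j} = (if P X1 then {X1} else {}) \<union> (if P X2 then {X2} else {}) \<union>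
      (if P X3 then {X3} else {})" for P
  proof (rule set_eqI)
    fix j
    show "j \<in> {j. P j} \<longleftrightarrow> j \<in> (if P X1 then {X1} else {}) \<union> (if P X2 then {X2} else {}) \<union>
        (if P X3 then {X3} else {})"
      by (cases j) auto
  qed
  show "place_sign X1 \<kappa> = 1"
    "place_sign X2 \<kappa> = (-1) ^ of_bool (\<kappa> X1)"
    "place_sign X3 \<kappa> = (-1) ^ (of_bool (\<kappa> X1) + of_bool (\<kappa> X2))"
    unfolding place_sign_def by (subst all, simp)+
qed

lemma dx_wedge_basis_form:
  assumes "\<not> \<mu> k"
  shows "dx k \<and>\<^sub>f basis_form \<mu> = place_sign k \<mu> *\<^sub>R basis_form (\<mu>(k := True))"
proof -
  have "(dx k \<and>\<^sub>f basis_form \<mu>) $ \<kappa> = (place_sign k \<mu> *\<^sub>R basis_form (\<mu>(k := True))) $ \<kappa>" for \<kappa>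
  proof (cases "\<kappa> = \<mu>(k := True)")
    case True
    have "\<mu>(k := False) = \<mu>" using assms by (simp add: fun_upd_idem)
    then show ?thesis by (simp add: True dx_wedge_nth basis_form_def)
  next
    case False
    have "\<kappa>(k := False) \<noteq> \<mu>" if "\<kappa> k"
    proof
      assume "\<kappa>(k := False) = \<mu>"
      then have "\<mu>(k := True) = \<kappa>(k := True)" by (simp flip: \<open>\<kappa>(k := False) = \<mu>\<close>)
      also have "\<dots> = \<kappa>" using that by (simp add: fun_upd_idem)
      finally show False using False by simp
    qed
    with False show ?thesis by (simp add: dx_wedge_nth basis_form_def axis_def)
  qed
  then show ?thesis by (simp add: vec_eq_iff)
qed

lemma basis_form_eq_wedge:
  "basis_form \<kappa> =
     (if \<kappa> X1 then (\<and>\<^sub>f) (dx X1) else id)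
       ((if \<kappa> X2 then (\<and>\<^sub>f) (dx X2) else id)
         ((if \<kappa> X3 then (\<and>\<^sub>f) (dx X3) else id) (basis_form (\<lambda>_. False))))"
proof -
  have "\<kappa> j = ((\<lambda>_. False)(X3 := \<kappa> X3, X2 := \<kappa> X2, X1 := \<kappa> X1)) j" for j
    by (cases j) simp_all
  then have eq: "\<kappa> = (\<lambda>_. False)(X3 := \<kappa> X3, X2 := \<kappa> X2, X1 := \<kappa> X1)"
    by (rule ext)
  have noop: "(\<lambda>_. False)(k := False) = (\<lambda>_. False)" for k :: coord
    by (rule ext) simp
  show ?thesis
    by (subst (1) eq, cases "\<kappa> X1"; cases "\<kappa> X2"; cases "\<kappa> X3")
      (simp_all add: dx_wedge_basis_form place_sign_simps noop fun_upd_idem)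
qed

text \<open>
  The interior product is the antiderivation that vanishes on constants and sends \<open>dx j\<close>
  to the Kronecker delta.
\<close>

lemma contract_dx_wedge:
  "contract k (dx j \<and>\<^sub>f \<phi>) = (if j = k then \<phi> else 0) - dx j \<and>\<^sub>f contract k \<phi>"
proof (cases "j = k")
  case True
  then show ?thesis
    by (auto simp: vec_eq_iff contract_nth dx_wedge_nth fun_upd_idem mult.assoc [symmetric])
next
  case False
  then have tw: "\<kappa>(k := True, j := False) = \<kappa>(j := False, k := True)" for \<kappa> :: "coord \<Rightarrow> bool"
    by (simp add: fun_upd_twist)
  have sign: "place_sign k \<kappa> * (place_sign j (\<kappa>(k := True)) * x)
          = - (place_sign j \<kappa> * (place_sign k (\<kappa>(j := False)) * x))"
    if "\<kappa> j" "\<not> \<kappa> k" for \<kappa> and x :: real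
    using False that by (cases j; cases k) (auto simp: place_sign_simps)
  have "contract k (dx j \<and>\<^sub>f \<phi>) $ \<kappa> = - (dx j \<and>\<^sub>f contract k \<phi>) $ \<kappa>" for \<kappa>
    using False sign [of \<kappa> "\<phi> $ (\<kappa>(j := False, k := True))"]
    by (simp add: contract_nth dx_wedge_nth tw)
  with False show ?thesis by (simp add: vec_eq_iff)
qed

lemma contract_const: "contract k (basis_form (\<lambda>_. False)) = 0"
  by (auto simp: vec_eq_iff contract_nth basis_form_def axis_def fun_eq_iff)

lemma clifford_nth:
  "clifford k \<phi> $ \<kappa> =
     (if \<kappa> k then place_sign k \<kappa> * \<phi> $ (\<kappa>(k := False))
      else - place_sign k \<kappa> * \<phi> $ (\<kappa>(k := True)))"
  by (simp add: clifford_def dx_wedge_nth contract_nth)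

lemma linear_clifford: "linear (clifford k)"
  by (simp add: linear_iff vec_eq_iff clifford_nth algebra_simps)

lemma clifford_square: "clifford k (clifford k \<phi>) = - \<phi>"
  by (auto simp: vec_eq_iff clifford_nth fun_upd_idem mult.assoc [symmetric])

lemma ex1_beta:
  "\<exists>!B. linear B \<and> (\<forall>\<phi> \<kappa>. B (clifford k \<phi>) $ \<kappa> = (-1) ^ of_bool (\<kappa> k) * \<phi> $ \<kappa>)"
proof (rule ex_ex1I)
  let ?B = "\<lambda>\<phi>. - (\<chi> \<kappa>. (-1) ^ of_bool (\<kappa> k) * clifford k \<phi> $ \<kappa>)"
  have "linear ?B"
    by (simp add: linear_iff vec_eq_iff algebra_simps
        linear_add [OF linear_clifford] linear_scale [OF linear_clifford])
  then show "\<exists>B. linear B \<and> (\<forall>\<phi> \<kappa>. B (clifford k \<phi>) $ \<kappa> = (-1) ^ of_bool (\<kappa> k) * \<phi> $ \<kappa>)"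
    by (intro exI [of _ ?B]) (simp add: clifford_square)
next
  fix B B' :: "form \<Rightarrow> form"
  assume "linear B \<and> (\<forall>\<phi> \<kappa>. B (clifford k \<phi>) $ \<kappa> = (-1) ^ of_bool (\<kappa> k) * \<phi> $ \<kappa>)"
    and "linear B' \<and> (\<forall>\<phi> \<kappa>. B' (clifford k \<phi>) $ \<kappa> = (-1) ^ of_bool (\<kappa> k) * \<phi> $ \<kappa>)"
  then have eq: "B (clifford k \<phi>) = B' (clifford k \<phi>)" for \<phi>
    by (simp add: vec_eq_iff)
  have "B \<phi> = B' \<phi>" for \<phi>
    using eq [of "- clifford k \<phi>"]
    by (simp add: linear_neg [OF linear_clifford] clifford_square)
  then show "B = B'" by blast
qed

definition beta :: "coord \<Rightarrow> form \<Rightarrow> form" where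
  "beta k = (THE B. linear B \<and>
     (\<forall>\<phi> \<kappa>. B (clifford k \<phi>) $ \<kappa> = (-1) ^ of_bool (\<kappa> k) * \<phi> $ \<kappa>))"

lemma linear_beta: "linear (beta k)"
  and beta_clifford: "beta k (clifford k \<phi>) $ \<kappa> = (-1) ^ of_bool (\<kappa> k) * \<phi> $ \<kappa>"
  using theI' [OF ex1_beta [of k]] unfolding beta_def by blast+

definition form_representation :: "(dirac_algebra \<Rightarrow> form \<Rightarrow> form) \<Rightarrow> bool" where
  "form_representation \<rho> \<longleftrightarrow>
     is_representation \<rho> \<and>
     (\<forall>k. \<rho> (gamma (Space k)) = clifford k) \<and>
     \<rho> charge_conj = beta X1 \<and>
     \<rho> (charge_conj * imag_unit) = beta X2 \<and>
     \<rho> (- imag_unit * gamma Time * gamma (Space X1) * gamma (Space X2) * gamma (Space X3)) = beta X3"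

end

(* The six operators clifford k and beta k pairwise anticommute and square to -1 and 1. Since
   imag_unit = C (C i) and gamma Time can be solved for in terms of the six prescribed elements,
   these relations give existence and uniqueness on forms. Conversely, on any nonzero
   representation the involutions "beta k after gamma k" commute and have a common nonzero fixed
   vector v; sending each basis form to the corresponding product of gammas applied to v is an
   injective map out of the space of forms, by projecting on joint eigenspaces, and on spinors a
   dimension count makes it bijective. Pulling the spinor representation back along it gives a
   form representation, so uniqueness turns it into an intertwiner. *)

theory Submission
  imports Defs
begin


section \<open>Anticommuting operators on forms\<close>

text \<open>The factor (-1)^(\<kappa> k) cancels the sign that separates wedge from contraction in
  \<open>clifford k\<close>, so \<open>beta k\<close> is dx^k wedge plus contraction.\<close>

lemma beta_nth: "beta k \<phi> $ \<kappa> = place_sign k \<kappa> * \<phi> $ (\<kappa>(k := \<not> \<kappa> k))"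
proof -
  have "beta k \<phi> = beta k (clifford k (- clifford k \<phi>))"
    by (simp add: linear_neg [OF linear_clifford] clifford_square)
  then show ?thesis by (simp add: beta_clifford clifford_nth)
qed

lemma clifford_nth_flip:
  "clifford k \<phi> $ \<kappa> = (-1) ^ of_bool (\<not> \<kappa> k) * place_sign k \<kappa> * \<phi> $ (\<kappa>(k := \<not> \<kappa> k))"
  by (simp add: clifford_nth)

lemma beta_square: "beta k (beta k \<phi>) = \<phi>"
  by (simp add: vec_eq_iff beta_nth mult.assoc [symmetric])

text \<open>Of the two place signs only that of the larger index counts the smaller one, so exactly
  one of them changes under the other's flip.\<close>

lemma place_sign_swap:
  "j \<noteq> k \<Longrightarrow> place_sign j \<kappa> * place_sign k (\<kappa>(j := \<not> \<kappa> j)) =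
     - (place_sign k \<kappa> * place_sign j (\<kappa>(k := \<not> \<kappa> k)))"
  by (cases j; cases k) (simp_all add: place_sign_simps)

text \<open>The factors \<open>s\<close> and \<open>t\<close> read only their own bit, which the
  other operator leaves alone; the one remaining sign is that of
  \<open>place_sign_swap\<close>.\<close>

lemma flip_anticommute:
  assumes "j \<noteq> k"
    and "\<And>\<phi> \<kappa>. A \<phi> $ \<kappa> = s (\<kappa> j) * place_sign j \<kappa> * \<phi> $ (\<kappa>(j := \<not> \<kappa> j))"
    and "\<And>\<phi> \<kappa>. B \<phi> $ \<kappa> = t (\<kappa> k) * place_sign k \<kappa> * \<phi> $ (\<kappa>(k := \<not> \<kappa> k))"
  shows "A (B \<phi>) = - B (A \<phi>)"
proof -
  have "A (B \<phi>) $ \<kappa> = - B (A \<phi>) $ \<kappa>" for \<kappa>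
  proof -
    have "A (B \<phi>) $ \<kappa> = s (\<kappa> j) * t (\<kappa> k)
        * (place_sign j \<kappa> * place_sign k (\<kappa>(j := \<not> \<kappa> j)))
        * \<phi> $ (\<kappa>(k := \<not> \<kappa> k, j := \<not> \<kappa> j))"
      using assms(1) by (simp add: assms(2,3) fun_upd_twist)
    also have "\<dots> = - B (A \<phi>) $ \<kappa>"
      unfolding place_sign_swap [OF assms(1)] using assms(1) by (simp add: assms(2,3))
    finally show ?thesis .
  qed
  then show ?thesis by (simp add: vec_eq_iff)
qed

lemma clifford_anticommute:
  "j \<noteq> k \<Longrightarrow> clifford j (clifford k \<phi>) = - clifford k (clifford j \<phi>)"
  by (rule flip_anticommute [where s = "\<lambda>c. (-1) ^ of_bool (\<not> c)"
        and t = "\<lambda>c. (-1) ^ of_bool (\<not> c)"]) (simp_all add: clifford_nth_flip)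

lemma beta_anticommute: "j \<noteq> k \<Longrightarrow> beta j (beta k \<phi>) = - beta k (beta j \<phi>)"
  by (rule flip_anticommute [where s = "\<lambda>_. 1" and t = "\<lambda>_. 1"]) (simp_all add: beta_nth)

lemma clifford_beta: "clifford j (beta k \<phi>) = - beta k (clifford j \<phi>)"
proof (cases "j = k")
  \<comment> \<open>Both operators flip the same bit, and \<open>clifford\<close> reads its sign
    from that bit before or after the flip of \<open>beta\<close>, with opposite results.\<close>
  case True
  then show ?thesis by (auto simp: vec_eq_iff beta_nth clifford_nth_flip)
next
  case False
  then show ?thesis
    by (rule flip_anticommute [where s = "\<lambda>c. (-1) ^ of_bool (\<not> c)"
          and t = "\<lambda>_. 1"]) (simp_all add: beta_nth clifford_nth_flip)
qed

section \<open>Existence and uniqueness of the form representation\<close>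

text \<open>The values at i and gamma^0 are forced: i = C(Ci), and the condition on
  \<open>beta X3\<close> says gamma^0 G = beta^1 beta^2 beta^3 for G = gamma^1 gamma^2 gamma^3,
  where G^2 = 1.\<close>

fun form_gen :: "dirac_gen \<Rightarrow> form \<Rightarrow> form" where
  "form_gen (GGamma (Space k)) \<phi> = clifford k \<phi>"
| "form_gen (GGamma Time) \<phi> =
     beta X1 (beta X2 (beta X3 (clifford X1 (clifford X2 (clifford X3 \<phi>)))))"
| "form_gen GI \<phi> = beta X1 (beta X2 \<phi>)"
| "form_gen GC \<phi> = beta X1 \<phi>"

text \<open>Oriented as rewrite rules to a normal form: all \<open>beta\<close> to the left of all
  \<open>clifford\<close>, indices increasing, squares removed.\<close>

lemmas form_anticommute =
  clifford_beta clifford_square beta_square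
  clifford_anticommute [of X2 X1, simplified] clifford_anticommute [of X3 X1, simplified]
  clifford_anticommute [of X3 X2, simplified]
  beta_anticommute [of X2 X1, simplified] beta_anticommute [of X3 X1, simplified]
  beta_anticommute [of X3 X2, simplified]
  linear_neg [OF linear_clifford] linear_neg [OF linear_beta]

lemma form_gen_relations: "satisfies_dirac_relations form_gen"
proof -
  have lin: "linear (form_gen x)" for x
  proof (cases x)
    case (GGamma \<mu>)
    show ?thesis
      by (cases \<mu>) (simp_all add: GGamma linear_iff linear_add [OF linear_clifford]
          linear_scale [OF linear_clifford] linear_add [OF linear_beta] linear_scale [OF linear_beta])
  qed (simp_all add: linear_iff linear_add [OF linear_beta] linear_scale [OF linear_beta])
  have "form_gen (GGamma \<mu>) (form_gen (GGamma \<nu>) v) + form_gen (GGamma \<nu>) (form_gen (GGamma \<mu>) v)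
      = (2 * eta \<mu> \<nu>) *\<^sub>R v" for \<mu> \<nu> v
  proof (cases \<mu>)
    case Time
    show ?thesis
    proof (cases \<nu>)
      case Time
      then show ?thesis
        by (simp add: \<open>\<mu> = Time\<close> eta_def form_anticommute scaleR_2)
    next
      case (Space k)
      then show ?thesis
        by (cases k) (simp_all add: \<open>\<mu> = Time\<close> eta_def form_anticommute)
    qed
  next
    case (Space j)
    show ?thesis
    proof (cases \<nu>)
      case Time
      then show ?thesis
        by (cases j) (simp_all add: Space eta_def form_anticommute)
    next
      case (Space k)
      then show ?thesis
        using \<open>\<mu> = Space j\<close>
        by (cases "j = k") (simp_all add: eta_def clifford_square clifford_anticommute [of j k] scaleR_2)
    qed
  qed
  moreover have "form_gen GI (form_gen (GGamma \<mu>) v) = form_gen (GGamma \<mu>) (form_gen GI v)"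
    "form_gen GC (form_gen (GGamma \<mu>) v) + form_gen (GGamma \<mu>) (form_gen GC v) = 0" for \<mu> v
    by (cases \<mu>; simp add: form_anticommute)+
  ultimately show ?thesis
    using lin unfolding satisfies_dirac_relations_def by (simp add: form_anticommute)
qed

lemma representation_simps:
  assumes "is_representation \<rho>"
  shows "linear (\<rho> a)" "\<rho> (a + b) v = \<rho> a v + \<rho> b v" "\<rho> (r *\<^sub>R a) v = r *\<^sub>R \<rho> a v"
    "\<rho> (a * b) v = \<rho> a (\<rho> b v)" "\<rho> 1 v = v" "\<rho> (- a) v = - \<rho> a v" "\<rho> a (- v) = - \<rho> a v"
proof -
  show lin: "linear (\<rho> a)" and scale: "\<rho> (r *\<^sub>R a) v = r *\<^sub>R \<rho> a v" for r
    using assms by (simp_all add: is_representation_def)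
  show "\<rho> (a + b) v = \<rho> a v + \<rho> b v" "\<rho> (a * b) v = \<rho> a (\<rho> b v)" "\<rho> 1 v = v"
    using assms by (simp_all add: is_representation_def)
  show "\<rho> (- a) v = - \<rho> a v" using scale [of "-1"] by simp
  show "\<rho> a (- v) = - \<rho> a v" by (rule linear_neg [OF lin])
qed

text \<open>Turns the prescribed values into values on the generators, where the universal property
  \<open>representation_of_generators\<close> applies.\<close>

lemma form_representation_iff:
  "form_representation \<rho> \<longleftrightarrow> is_representation \<rho> \<and>
     (\<forall>\<mu>. \<rho> (gamma \<mu>) = form_gen (GGamma \<mu>)) \<and>
     \<rho> imag_unit = form_gen GI \<and> \<rho> charge_conj = form_gen GC" (is "?L \<longleftrightarrow> ?R")
proof
  assume ?L
  then have rep: "is_representation \<rho>"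
    and g: "\<And>k. \<rho> (gamma (Space k)) = clifford k" and C: "\<rho> charge_conj = beta X1"
    and Ci: "\<And>v. \<rho> (charge_conj * imag_unit) v = beta X2 v"
    and b3: "\<And>v. \<rho> (- imag_unit * gamma Time * gamma (Space X1) * gamma (Space X2)
               * gamma (Space X3)) v = beta X3 v"
    by (simp_all add: form_representation_def)
  note rs = representation_simps [OF rep]
  have i: "\<rho> imag_unit v = beta X1 (beta X2 v)" for v
    using Ci [of v] by (simp add: rs C beta_square flip: Ci)
  have "\<rho> (gamma Time) v = form_gen (GGamma Time) v" for v
  proof -
    \<comment> \<open>Evaluating the third condition at \<open>?G v\<close> isolates gamma^0,
      because \<open>?G\<close> is an involution; beta^1 beta^2 squares to -1 and is then
      inverted.\<close>
    let ?G = "\<lambda>v. clifford X1 (clifford X2 (clifford X3 v))"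
    let ?u = "\<rho> (gamma Time) (?G (?G v))"
    have "- beta X1 (beta X2 ?u) = beta X3 (?G v)"
      using b3 [of "?G v"] by (simp add: rs g i)
    then have "beta X1 (beta X2 (- beta X1 (beta X2 ?u))) = beta X1 (beta X2 (beta X3 (?G v)))"
      by simp
    then show ?thesis by (simp add: form_anticommute)
  qed
  then have "\<rho> (gamma \<mu>) = form_gen (GGamma \<mu>)" for \<mu>
    using g by (cases \<mu>) (auto simp: fun_eq_iff)
  moreover have "\<rho> imag_unit = form_gen GI" "\<rho> charge_conj = form_gen GC"
    using i C by (auto simp: fun_eq_iff)
  ultimately show ?R using rep by blast
next
  assume R: ?R
  then have rep: "is_representation \<rho>" by blast
  note rs = representation_simps [OF rep]
  show ?L
    unfolding form_representation_def fun_eq_iff using R by (simp add: rs form_anticommute)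
qed

lemma ex1_form_representation: "\<exists>!\<rho>. form_representation \<rho>"
  unfolding form_representation_iff by (rule representation_of_generators [OF form_gen_relations])

section \<open>Embedding the forms into a representation\<close>

lemma linear_basis_form_eqI:
  fixes f g :: "form \<Rightarrow> 'v :: real_vector"
  assumes "linear f" "linear g" and "\<And>\<kappa>. f (basis_form \<kappa>) = g (basis_form \<kappa>)"
  shows "f \<phi> = g \<phi>"
proof -
  have "f b = g b" if "b \<in> Basis" for b
    using that assms(3) by (auto simp: Basis_vec_def basis_form_def)
  then show ?thesis
    using linear_eq_stdbasis [OF assms(1,2)] by (simp add: fun_eq_iff)
qed

lemma flip_eq_iff: "\<kappa>(k := \<not> \<kappa> k) = \<mu> \<longleftrightarrow> \<kappa> = \<mu>(k := \<not> \<mu> k)"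
  by auto

lemma beta_basis_form:
  "beta k (basis_form \<mu>) = place_sign k \<mu> *\<^sub>R basis_form (\<mu>(k := \<not> \<mu> k))"
  by (auto simp: vec_eq_iff beta_nth basis_form_def axis_def flip_eq_iff)

lemma clifford_basis_form:
  "clifford k (basis_form \<mu>) =
     ((-1) ^ of_bool (\<mu> k) * place_sign k \<mu>) *\<^sub>R basis_form (\<mu>(k := \<not> \<mu> k))"
  by (auto simp: vec_eq_iff clifford_nth_flip basis_form_def axis_def flip_eq_iff)

text \<open>These are the relations of the real Clifford algebra of signature (3,3), which is the
  algebra of real 8 x 8 matrices.\<close>

locale anticommuting_operators =
  fixes g b :: "coord \<Rightarrow> 'v \<Rightarrow> ('v :: real_vector)"
  assumes linear_g: "linear (g k)" and linear_b: "linear (b k)"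
    and g_square: "g k (g k v) = - v" and b_square: "b k (b k v) = v"
    and g_anticommute: "j \<noteq> k \<Longrightarrow> g j (g k v) = - g k (g j v)"
    and b_anticommute: "j \<noteq> k \<Longrightarrow> b j (b k v) = - b k (b j v)"
    and b_g: "b j (g k v) = - g k (b j v)"
begin

section \<open>Joint eigenvectors of the commuting involutions\<close>

lemmas g_b_linear_simps =
  linear_neg [OF linear_g] linear_neg [OF linear_b] linear_add [OF linear_g]
  linear_add [OF linear_b] linear_0 [OF linear_g] linear_0 [OF linear_b]

lemma g_eq_0_iff: "g k v = 0 \<longleftrightarrow> v = 0"
  by (metis g_square linear_0 [OF linear_g] neg_equal_0_iff_equal)

text \<open>Each factor of one product passes both factors of the other, and the four signs
  cancel.\<close>

lemma bg_commute: "j \<noteq> k \<Longrightarrow> b j (g j (b k (g k v))) = b k (g k (b j (g j v)))"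
  by (simp add: b_g b_anticommute [of j k] g_anticommute [of j k] g_b_linear_simps)

lemma bg_g_commute: "j \<noteq> k \<Longrightarrow> b j (g j (g k v)) = g k (b j (g j v))"
  by (simp add: b_g g_anticommute [of j k] g_b_linear_simps)

text \<open>The conditions are imposed one index at a time; commutation with the earlier involutions
  preserves what has already been achieved.\<close>

lemma common_fixed_vector:
  assumes "(w :: 'v) \<noteq> 0"
  obtains v where "v \<noteq> 0" "\<And>k. b k (g k v) = v"
proof -
  have "\<exists>v. v \<noteq> 0 \<and> (\<forall>k\<in>J. b k (g k v) = v)" for J
    using finite [of J]
  proof (induction J)
    case empty
    then show ?case using assms by auto
  next
    case (insert k J)
    then obtain u where u: "u \<noteq> 0" "\<And>j. j \<in> J \<Longrightarrow> b j (g j u) = u" by auto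
    have ne: "j \<noteq> k" if "j \<in> J" for j using that insert.hyps by blast
    show ?case
    proof (cases "u + b k (g k u) = 0")
      \<comment> \<open>Here \<open>u\<close> has eigenvalue -1, and \<open>g k\<close> anticommutes
        with the new involution, so \<open>g k u\<close> has eigenvalue 1.\<close>
      case True
      then have "b k (g k u) = - u" by (simp add: eq_neg_iff_add_eq_0 add.commute)
      then have "b k (g k (g k u)) = g k u"
        by (simp add: b_g [of k k "g k u"] g_b_linear_simps)
      with u ne show ?thesis
        by (intro exI [of _ "g k u"]) (auto simp: g_eq_0_iff bg_g_commute [of _ k])
    next
      \<comment> \<open>The nonzero sum is, up to a factor 2, the projection of \<open>u\<close>
        onto the eigenvalue 1.\<close>
      case False
      have "b k (g k (b k (g k u))) = u"
        by (simp add: b_g g_square b_square g_b_linear_simps)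
      with False u ne show ?thesis
        by (intro exI [of _ "u + b k (g k u)"]) (auto simp: g_b_linear_simps bg_commute [of _ k])
    qed
  qed
  then show ?thesis using that by blast
qed

text \<open>The fixed vector plays the role of the constant form 1, which \<open>beta k\<close>
  after \<open>clifford k\<close> also fixes.\<close>

lemma embedding_of_forms:
  assumes "(w :: 'v) \<noteq> 0"
  obtains T :: "form \<Rightarrow> 'v" where "linear T" "inj T"
    "\<And>k \<phi>. T (clifford k \<phi>) = g k (T \<phi>)" "\<And>k \<phi>. T (beta k \<phi>) = b k (T \<phi>)"
proof -
  obtain v where v: "v \<noteq> 0" "\<And>k. b k (g k v) = v"
    using common_fixed_vector [OF assms] by blast
  \<comment> \<open>On \<open>v\<close> every \<open>b k\<close> can be traded for
    \<open>g k\<close>, so the span of the products of the \<open>g k\<close> applied to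
    \<open>v\<close> is stable under all \<open>b k\<close>.\<close>
  have bv: "b k v = g k v" for k
    using b_square v(2) by metis
  \<comment> \<open>The factors stand in increasing order as in the wedge product, so sorting a new
    factor into place costs exactly \<open>place_sign\<close>, and the coefficients in
    \<open>ge\<close> and \<open>be\<close> match those on basis forms.\<close>
  define pw where "pw k c = (if c then g k else id)" for k c
  define e where "e \<kappa> = pw X1 (\<kappa> X1) (pw X2 (\<kappa> X2) (pw X3 (\<kappa> X3) v))" for \<kappa>
  define T where "T \<phi> = (\<Sum>\<kappa>\<in>UNIV. \<phi> $ \<kappa> *\<^sub>R e \<kappa>)" for \<phi> :: form
  have e0: "e \<kappa> \<noteq> 0" for \<kappa>
    using v(1) by (simp add: e_def pw_def g_eq_0_iff)
  note g_sort = g_square g_anticommute [of X2 X1, simplified] g_anticommute [of X3 X1, simplified]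
    g_anticommute [of X3 X2, simplified] g_b_linear_simps
  have ge: "g k (e \<mu>) = ((-1) ^ of_bool (\<mu> k) * place_sign k \<mu>) *\<^sub>R e (\<mu>(k := \<not> \<mu> k))" for k \<mu>
    by (cases k; cases "\<mu> X1"; cases "\<mu> X2"; cases "\<mu> X3")
      (simp_all add: e_def pw_def place_sign_simps g_sort)
  have be: "b k (e \<mu>) = place_sign k \<mu> *\<^sub>R e (\<mu>(k := \<not> \<mu> k))" for k \<mu>
    by (cases k; cases "\<mu> X1"; cases "\<mu> X2"; cases "\<mu> X3")
      (simp_all add: e_def pw_def place_sign_simps b_g bv g_sort)
  have lin: "linear T"
    by (simp add: T_def linear_iff scaleR_add_left sum.distrib scaleR_sum_right)
  have Te: "T (basis_form \<kappa>) = e \<kappa>" for \<kappa>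
  proof -
    have "T (basis_form \<kappa>) = (\<Sum>\<mu>\<in>UNIV. if \<mu> = \<kappa> then e \<mu> else 0)"
      unfolding T_def basis_form_def axis_def by (rule sum.cong) auto
    then show ?thesis by simp
  qed
  have Tg: "T (clifford k \<phi>) = g k (T \<phi>)" for k \<phi>
    by (rule linear_basis_form_eqI [OF linear_compose [OF linear_clifford lin, unfolded o_def]
          linear_compose [OF lin linear_g, unfolded o_def]])
      (simp add: clifford_basis_form Te ge linear_scale [OF lin])
  have Tb: "T (beta k \<phi>) = b k (T \<phi>)" for k \<phi>
    by (rule linear_basis_form_eqI [OF linear_compose [OF linear_beta lin, unfolded o_def]
          linear_compose [OF lin linear_b, unfolded o_def]])
      (simp add: beta_basis_form Te be linear_scale [OF lin])
  have "\<phi> = 0" if "T \<phi> = 0" for \<phi>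
  proof -
    have "\<phi> $ \<kappa> = 0" for \<kappa>
    proof -
      have "\<exists>\<psi>. T \<psi> = 0 \<and> (\<forall>\<mu>. \<psi> $ \<mu> = (if \<forall>j\<in>J. \<mu> j = \<kappa> j then \<phi> $ \<mu> else 0))" for J
        using finite [of J]
      proof (induction J)
        case empty
        then show ?case using that by auto
      next
        case (insert k J)
        then obtain \<psi> where \<psi>: "T \<psi> = 0"
          "\<And>\<mu>. \<psi> $ \<mu> = (if \<forall>j\<in>J. \<mu> j = \<kappa> j then \<phi> $ \<mu> else 0)"
          by auto
        \<comment> \<open>\<open>beta k\<close> after \<open>clifford k\<close> is diagonal with
          entries (-1)^(\<mu> k), so this keeps just the components with
          \<open>\<mu> k = \<kappa> k\<close>. It stays in the kernel because \<open>T\<close>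
          intertwines both operators.\<close>
        let ?\<psi> = "(1/2) *\<^sub>R (\<psi> + (-1) ^ of_bool (\<kappa> k) *\<^sub>R beta k (clifford k \<psi>))"
        have "T ?\<psi> = 0"
          by (simp add: linear_add [OF lin] linear_scale [OF lin] Tb Tg \<psi>(1) g_b_linear_simps)
        moreover have "?\<psi> $ \<mu> = (if \<forall>j\<in>insert k J. \<mu> j = \<kappa> j then \<phi> $ \<mu> else 0)" for \<mu>
          by (auto simp: beta_clifford \<psi>(2))
        ultimately show ?case by blast
      qed
      \<comment> \<open>Once all three bits are fixed only the component at \<open>\<kappa>\<close>
        is left, and \<open>e \<kappa>\<close> is nonzero.\<close>
      from this [of UNIV] obtain \<psi> where \<psi>: "T \<psi> = 0"
        "\<And>\<mu>. \<psi> $ \<mu> = (if \<forall>j. \<mu> j = \<kappa> j then \<phi> $ \<mu> else 0)"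
        by auto
      have "\<psi> = \<phi> $ \<kappa> *\<^sub>R basis_form \<kappa>"
        by (auto simp: vec_eq_iff \<psi>(2) basis_form_def axis_def simp flip: fun_eq_iff)
      then have "\<phi> $ \<kappa> *\<^sub>R e \<kappa> = 0"
        using \<psi>(1) by (simp add: linear_scale [OF lin] Te)
      then show ?thesis using e0 by simp
    qed
    then show ?thesis by (simp add: vec_eq_iff)
  qed
  then have "inj T" using linear_injective_0 [OF lin] by blast
  then show ?thesis using that lin Tg Tb by blast
qed

end

section \<open>Equivalence with the spinor representation\<close>

text \<open>The elements prescribed to act as the \<open>beta k\<close>; relations proved for them
  in the algebra hold in every representation.\<close>

fun beta_element :: "coord \<Rightarrow> dirac_algebra" where
  "beta_element X1 = charge_conj"
| "beta_element X2 = charge_conj * imag_unit"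
| "beta_element X3 = - imag_unit * gamma Time * gamma (Space X1) * gamma (Space X2) * gamma (Space X3)"

section \<open>Normal ordering in the Dirac algebra\<close>

lemma gamma_anticommute: "\<mu> \<noteq> \<nu> \<Longrightarrow> gamma \<mu> * gamma \<nu> = - (gamma \<nu> * gamma \<mu>)"
  using dirac_algebra_relations(1) [of \<mu> \<nu>] by (simp add: eta_def eq_neg_iff_add_eq_0)

lemma gamma_square: "gamma \<mu> * gamma \<mu> = eta \<mu> \<mu> *\<^sub>R 1"
proof -
  have "2 *\<^sub>R (gamma \<mu> * gamma \<mu>) = 2 *\<^sub>R (eta \<mu> \<mu> *\<^sub>R 1)"
    using dirac_algebra_relations(1) [of \<mu> \<mu>] by (simp add: scaleR_2)
  then show ?thesis by (simp only: scaleR_cancel_left) simp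
qed

text \<open>Rewrite rules towards the order C, i, gamma^0, gamma^1, gamma^2, gamma^3.\<close>

lemma dirac_sort:
  "gamma (Space k) * gamma Time = - (gamma Time * gamma (Space k))"
  "gamma (Space X2) * gamma (Space X1) = - (gamma (Space X1) * gamma (Space X2))"
  "gamma (Space X3) * gamma (Space X1) = - (gamma (Space X1) * gamma (Space X3))"
  "gamma (Space X3) * gamma (Space X2) = - (gamma (Space X2) * gamma (Space X3))"
  "gamma Time * gamma Time = 1"
  "gamma (Space k) * gamma (Space k) = -1"
  "gamma \<mu> * imag_unit = imag_unit * gamma \<mu>"
  "gamma \<mu> * charge_conj = - (charge_conj * gamma \<mu>)"
  "imag_unit * charge_conj = - (charge_conj * imag_unit)"
  "imag_unit * imag_unit = -1"
  "charge_conj * charge_conj = 1"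
  using dirac_algebra_relations(2) [of \<mu>] dirac_algebra_relations(3) [of \<mu>]
    dirac_algebra_relations(4-6)
  by (simp_all add: gamma_anticommute [of "Space k" Time] gamma_anticommute [of "Space X2" "Space X1"]
      gamma_anticommute [of "Space X3" "Space X1"] gamma_anticommute [of "Space X3" "Space X2"]
      gamma_square eta_def eq_neg_iff_add_eq_0 add.commute)

text \<open>The same rules inside right-nested products, where an adjacent pair is followed by a
  tail \<open>z\<close>.\<close>

lemma dirac_sort_assoc:
  "gamma (Space k) * (gamma Time * z) = - (gamma Time * (gamma (Space k) * z))"
  "gamma (Space X2) * (gamma (Space X1) * z) = - (gamma (Space X1) * (gamma (Space X2) * z))"
  "gamma (Space X3) * (gamma (Space X1) * z) = - (gamma (Space X1) * (gamma (Space X3) * z))"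
  "gamma (Space X3) * (gamma (Space X2) * z) = - (gamma (Space X2) * (gamma (Space X3) * z))"
  "gamma Time * (gamma Time * z) = z"
  "gamma (Space k) * (gamma (Space k) * z) = - z"
  "gamma \<mu> * (imag_unit * z) = imag_unit * (gamma \<mu> * z)"
  "gamma \<mu> * (charge_conj * z) = - (charge_conj * (gamma \<mu> * z))"
  "imag_unit * (charge_conj * z) = - (charge_conj * (imag_unit * z))"
  "imag_unit * (imag_unit * z) = - z"
  "charge_conj * (charge_conj * z) = z"
  by (simp_all add: dirac_sort flip: mult.assoc)

lemma beta_element_square: "beta_element k * beta_element k = 1"
  by (cases k) (simp_all add: mult.assoc dirac_sort dirac_sort_assoc)

lemma beta_element_anticommute:
  "j \<noteq> k \<Longrightarrow> beta_element j * beta_element k = - (beta_element k * beta_element j)"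
  by (cases j; cases k) (simp_all add: mult.assoc dirac_sort dirac_sort_assoc)

lemma beta_element_gamma:
  "beta_element j * gamma (Space k) = - (gamma (Space k) * beta_element j)"
  by (cases j; cases k) (simp_all add: mult.assoc dirac_sort dirac_sort_assoc)

section \<open>From the relations to the isomorphism\<close>

lemma representation_anticommuting_operators:
  fixes \<sigma> :: "dirac_algebra \<Rightarrow> 'v \<Rightarrow> ('v :: real_vector)"
  assumes rep: "is_representation \<sigma>"
  shows "anticommuting_operators (\<lambda>k. \<sigma> (gamma (Space k))) (\<lambda>k. \<sigma> (beta_element k))"
proof -
  note rs = representation_simps [OF rep]
  show ?thesis
  proof (rule anticommuting_operators.intro)
    fix j k :: coord and v :: 'v
    show "linear (\<sigma> (gamma (Space k)))" "linear (\<sigma> (beta_element k))" by (rule rs)+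
    show "\<sigma> (gamma (Space k)) (\<sigma> (gamma (Space k)) v) = - v"
      "\<sigma> (beta_element k) (\<sigma> (beta_element k) v) = v"
      "\<sigma> (beta_element j) (\<sigma> (gamma (Space k)) v) = - \<sigma> (gamma (Space k)) (\<sigma> (beta_element j) v)"
      by (simp_all add: dirac_sort beta_element_square beta_element_gamma rs(5,6) flip: rs(4))
    assume "j \<noteq> k"
    then show "\<sigma> (gamma (Space j)) (\<sigma> (gamma (Space k)) v) =
        - \<sigma> (gamma (Space k)) (\<sigma> (gamma (Space j)) v)"
      "\<sigma> (beta_element j) (\<sigma> (beta_element k) v) = - \<sigma> (beta_element k) (\<sigma> (beta_element j) v)"
      by (simp_all add: gamma_anticommute [of "Space j" "Space k"] beta_element_anticommute [of j k]
          rs(6) flip: rs(4))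
  qed
qed

text \<open>Stated for an arbitrary representation of real dimension 8, so that all choices of
  charge conjugation are covered at once.\<close>

lemma equivalent_to_form_representation:
  fixes \<sigma> :: "dirac_algebra \<Rightarrow> 'v \<Rightarrow> ('v :: euclidean_space)"
  assumes \<rho>: "form_representation \<rho>" and \<sigma>: "is_representation \<sigma>" and dim: "DIM('v) = 8"
  shows "equivalent_representations \<rho> \<sigma>"
proof -
  note rs = representation_simps [OF \<sigma>]
  interpret anticommuting_operators "\<lambda>k. \<sigma> (gamma (Space k))" "\<lambda>k. \<sigma> (beta_element k)"
    by (rule representation_anticommuting_operators [OF \<sigma>])
  have "(SOME w. w \<in> Basis) \<noteq> (0 :: 'v)"
    by (metis SOME_Basis nonzero_Basis)
  then obtain T :: "form \<Rightarrow> 'v" where lin: "linear T" and "inj T"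
    and Tg: "\<And>k \<phi>. T (clifford k \<phi>) = \<sigma> (gamma (Space k)) (T \<phi>)"
    and Tb: "\<And>k \<phi>. T (beta k \<phi>) = \<sigma> (beta_element k) (T \<phi>)"
    using embedding_of_forms by metis
  have "card (UNIV :: coord set) = 3"
    by (simp add: UNIV_coord)
  then have "DIM(form) = 8"
    by (simp add: card_fun)
  then have "dim (range T) = DIM('v)"
    using dim_image_eq [OF lin, of UNIV] \<open>inj T\<close> dim by simp
  then have "range T = UNIV"
    using dim_eq_full [of "range T"] linear_subspace_image [OF lin subspace_UNIV]
    by (metis span_eq_iff)
  with \<open>inj T\<close> have "bij T" by (simp add: bij_def)
  have inv: "T (inv T y) = y" "inv T (T x) = x" for x y
    using \<open>bij T\<close> by (simp_all add: bij_is_surj surj_f_inv_f bij_is_inj)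
  have lin_inv: "linear (inv T)"
    unfolding linear_iff
    by (metis inv linear_add [OF lin] linear_scale [OF lin])
  \<comment> \<open>So far \<open>T\<close> intertwines only the six prescribed elements. The
    pullback \<open>\<tau>\<close> satisfies the prescriptions, so uniqueness gives
    \<open>\<tau> = \<rho>\<close> and hence intertwining on the whole algebra.\<close>
  define \<tau> where "\<tau> a v = inv T (\<sigma> a (T v))" for a v
  have "linear (\<tau> a)" for a
    using linear_compose [OF linear_compose [OF lin rs(1)] lin_inv]
    by (simp add: \<tau>_def [abs_def] o_def)
  then have "is_representation \<tau>"
    by (auto simp: is_representation_def \<tau>_def fun_eq_iff rs inv linear_add [OF lin_inv]
        linear_scale [OF lin_inv])
  moreover have g: "\<tau> (gamma (Space k)) = clifford k" and b: "\<tau> (beta_element k) = beta k" for k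
    by (simp_all add: fun_eq_iff \<tau>_def inv flip: Tg Tb)
  ultimately have "form_representation \<tau>"
    using b [of X1] b [of X2] b [of X3] by (simp add: form_representation_def)
  then have "\<tau> = \<rho>"
    using \<rho> ex1_form_representation by blast
  then have "T (\<rho> a v) = \<sigma> a (T v)" for a v
    using inv(1) by (metis \<tau>_def)
  then show ?thesis
    unfolding equivalent_representations_def using lin \<open>bij T\<close> by blast
qed

theorem theorem2:
  shows "(\<exists>!\<rho>. form_representation \<rho>) \<and>
    (\<exists>\<sigma>. standard_representation \<sigma>) \<and>
    (\<forall>\<rho> \<sigma>. form_representation \<rho> \<longrightarrow> standard_representation \<sigma> \<longrightarrow>
       equivalent_representations \<rho> \<sigma>)"
proof -
  \<comment> \<open>The dimension condition holds since \<open>complex ^ 4\<close> has real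
    dimension 4 * 2.\<close>
  have "equivalent_representations \<rho> \<sigma>"
    if "form_representation \<rho>" "standard_representation \<sigma>" for \<rho> \<sigma>
    using that by (intro equivalent_to_form_representation) (simp_all add: standard_representation_def)
  then show ?thesis
    using ex1_form_representation standard_representation_exists by blast
qed

end
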